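(* Let $n\ge 2$ be an integer. For every $x\in\mathbb{C}\mathbb{Z}_n$ one has $q_1(\overline{x})=q_{n-1}(x)$.
   Context: $\mathbb{Z}_n$ is the cyclic group of order $n$, with elements $e_1,\dots,e_n$ where $e_i$ is the class of $i-1$ (so $e_ie_j=e_{i+j-1}$, subscripts mod $n$, and $e_1$ is the identity); $\mathbb{C}\mathbb{Z}_n$ is its complex group algebra. For $c_1,\dots,c_n\in\mathbb{C}$, $\operatorname{circ}(c_1,\dots,c_n)$ is the $n\times n$ circulant matrix whose $(i,j)$ entry is $c_{j-i+1}$ (subscripts mod $n$). For $x=c_1e_1+\dots+c_ne_n\in\mathbb{C}\mathbb{Z}_n$ the scalars $q_1(x),\dots,q_n(x)$ are defined by the characteristic polynomial $$\det\big(X I_n-\operatorname{circ}(c_1,\dots,c_n)\big)=X^n-q_1(x)X^{n-1}+q_2(x)X^{n-2}-\dots+(-1)^nq_n(x).$$ The conjugate of $x$ is the element of $\mathbb{C}\mathbb{Z}_n$ $$\overline{x}=(-1)^{n+1}x^{n-1}+(-1)^nq_1(x)x^{n-2}+\dots+q_{n-1}(x)=\sum_{k=0}^{n-1}(-1)^{n+1+k}q_k(x)\,x^{n-1-k},\qquad q_0(x):=1,$$ where scalars are identified with multiples of $e_1$. *)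

theory Defs
  imports
    "HOL-Library.Poly_Mapping"
    "Jordan_Normal_Form.Char_Poly"
    "Berlekamp_Zassenhaus.Finite_Field"
begin

text \<open>
  The additive group of \<^typ>\<open>'n mod_ring\<close> is the cyclic group of order \<open>CARD('n)\<close>; the
  multiplication of \<^typ>\<open>'n mod_ring\<close> plays no role here. Finitely supported functions from an
  additively written group to \<^typ>\<open>complex\<close>, with the convolution product of
  \<^theory>\<open>HOL-Library.Poly_Mapping\<close>, form its complex group algebra. The scalar \<open>c\<close>
  corresponds to \<open>Poly_Mapping.single 0 c\<close>.
\<close>

type_synonym 'n cyclic_algebra = "'n mod_ring \<Rightarrow>\<^sub>0 complex"

text \<open>Indices start at \<open>0\<close>: \<open>cls k\<close> is the class of \<open>k\<close>, so \<open>e\<^sub>i\<close> is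
  \<open>Poly_Mapping.single (cls (i - 1)) 1\<close>.\<close>

definition cls :: "nat \<Rightarrow> 'n::finite mod_ring" where
  "cls k = of_int_mod_ring (int k)"

definition coeffs_vec :: "'n::finite cyclic_algebra \<Rightarrow> complex vec" where
  "coeffs_vec x = vec CARD('n) (\<lambda>k. Poly_Mapping.lookup x (cls k))"

text \<open>With zero-based indices the entry at \<open>(i, j)\<close> is still the component of index \<open>j - i\<close>
  modulo \<open>n\<close>; the subtraction takes place in \<^typ>\<open>int\<close>.\<close>

definition circ :: "'a vec \<Rightarrow> 'a mat" where
  "circ c = mat (dim_vec c) (dim_vec c)
     (\<lambda>(i, j). c $ nat ((int j - int i) mod int (dim_vec c)))"

text \<open>The scalars \<open>q\<^sub>k\<close> are meant for \<open>k \<le> CARD('n)\<close>.\<close>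

definition q :: "nat \<Rightarrow> 'n::finite cyclic_algebra \<Rightarrow> complex" where
  "q k x = (-1) ^ k * poly.coeff (char_poly (circ (coeffs_vec x))) (CARD('n) - k)"

definition conjugate_elt :: "'n::finite cyclic_algebra \<Rightarrow> 'n cyclic_algebra" where
  "conjugate_elt x =
     (\<Sum>k<CARD('n). Poly_Mapping.single 0 ((-1) ^ (CARD('n) + 1 + k) * q k x)
                       * x ^ (CARD('n) - 1 - k))"

lemma cls_add: "cls i + cls j = cls (i + j)"
  unfolding cls_def by transfer (simp add: mod_simps)

lemma cls_inj: "inj_on (cls :: nat \<Rightarrow> 'n::finite mod_ring) {..<CARD('n)}"
proof (rule inj_onI)
  fix i j assume ij: "i \<in> {..<CARD('n)}" "j \<in> {..<CARD('n)}"
    and eq: "(cls i :: 'n mod_ring) = cls j"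
  from ij have "to_int_mod_ring (cls i :: 'n mod_ring) = int i"
    "to_int_mod_ring (cls j :: 'n mod_ring) = int j"
    by (simp_all add: cls_def)
  with eq show "i = j" by (metis of_nat_eq_iff)
qed

lemma cls_range: "(cls :: nat \<Rightarrow> 'n::finite mod_ring) ` {..<CARD('n)} = UNIV"
  by (intro card_subset_eq) (simp_all add: card_image[OF cls_inj])

lemma single_cls_mult:
  "Poly_Mapping.single (cls i) (1::complex) * Poly_Mapping.single (cls j) 1
     = Poly_Mapping.single (cls (i + j)) 1"
  by (simp add: mult_single cls_add)

lemma cyclic_algebra_expansion:
  fixes x :: "'n::finite cyclic_algebra"
  shows "x = (\<Sum>k<CARD('n). Poly_Mapping.single 0 (coeffs_vec x $ k) * Poly_Mapping.single (cls k) 1)"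
proof (rule poly_mapping_eqI)
  fix a :: "'n mod_ring"
  have "Poly_Mapping.lookup x a = (\<Sum>b\<in>UNIV. Poly_Mapping.lookup x b when b = a)"
    by (simp add: when_def)
  also have "\<dots> = (\<Sum>k<CARD('n). Poly_Mapping.lookup x (cls k) when cls k = a)"
    unfolding cls_range[symmetric] by (simp add: sum.reindex[OF cls_inj])
  finally show "Poly_Mapping.lookup x a = Poly_Mapping.lookup
      (\<Sum>k<CARD('n). Poly_Mapping.single 0 (coeffs_vec x $ k) * Poly_Mapping.single (cls k) 1) a"
    by (simp add: lookup_sum mult_single coeffs_vec_def lookup_single)
qed

lemma char_poly_circ_q:
  fixes x :: "'n::finite cyclic_algebra"
  shows "char_poly (circ (coeffs_vec x)) = (\<Sum>k\<le>CARD('n). Polynomial.monom ((-1) ^ k * q k x) (CARD('n) - k))"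
proof -
  let ?p = "char_poly (circ (coeffs_vec x))"
  have "circ (coeffs_vec x) \<in> carrier_mat CARD('n) CARD('n)"
    by (simp add: circ_def coeffs_vec_def)
  then have "degree ?p = CARD('n)" using degree_monic_char_poly by blast
  then have "?p = (\<Sum>i\<le>CARD('n). Polynomial.monom (poly.coeff ?p i) i)"
    using poly_as_sum_of_monoms[of ?p] by simp
  also have "\<dots> = (\<Sum>k\<le>CARD('n). Polynomial.monom (poly.coeff ?p (CARD('n) - k)) (CARD('n) - k))"
    by (rule sum.reindex_bij_witness[of _ "\<lambda>k. CARD('n) - k" "\<lambda>k. CARD('n) - k"]) auto
  finally show ?thesis by (simp add: q_def power_mult_distrib[symmetric] flip: mult.assoc)
qed

lemma q_0: "q 0 (x :: 'n::finite cyclic_algebra) = 1"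
proof -
  have "circ (coeffs_vec x) \<in> carrier_mat CARD('n) CARD('n)"
    by (simp add: circ_def coeffs_vec_def)
  then show ?thesis using degree_monic_char_poly by (auto simp: q_def)
qed

end

theory Submission
  imports Defs
begin

text \<open>
  The characters of the cyclic group diagonalise all circulant matrices simultaneously: extended
  linearly to the group algebra, they become \<open>n\<close> algebra homomorphisms, whose values
  \<open>\<lambda>\<^sub>0, \<dots>, \<lambda>\<^bsub>n-1\<^esub>\<close> at \<open>x\<close> are the eigenvalues of the circulant of \<open>x\<close>, counted with
  multiplicity (\<open>char_poly_circ\<close>). Hence \<open>q 1\<close> of any element is the sum of its character values.

  Write the characteristic polynomial of \<open>x\<close> as \<open>P = P(0) + X Q\<close>. The conjugate of \<open>x\<close> is
  \<open>(-1)\<^bsup>n+1\<^esup> Q(x)\<close>, so its character values are \<open>(-1)\<^bsup>n+1\<^esup> Q(\<lambda>\<^sub>m)\<close>. For an eigenvalue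
  \<open>\<lambda>\<^sub>m \<noteq> 0\<close> the equation \<open>P(\<lambda>\<^sub>m) = 0\<close> gives \<open>Q(\<lambda>\<^sub>m) = - P(0) / \<lambda>\<^sub>m\<close>, which is the product of
  the \<open>- \<lambda>\<^sub>j\<close> over \<open>j \<noteq> m\<close>; the product formula persists for \<open>\<lambda>\<^sub>m = 0\<close>
  (\<open>poly_quotient_at_root\<close>). Summed over \<open>m\<close>, these products form \<open>P'(0)\<close>, the linear coefficient
  of \<open>P\<close> (\<open>sum_poly_quotient_at_roots\<close>), which up to sign is \<open>q (n - 1) x\<close>.
\<close>

section \<open>Polynomials that split into linear factors\<close>

text \<open>
  Multiplying out the factorisation shows that \<open>Q\<close> and the constant \<open>R(0)\<close> differ by a multiple of
  \<open>X - a\<close>. No division by \<open>a\<close> occurs, so the root \<open>a = 0\<close> is covered.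
\<close>

lemma poly_quotient_at_root:
  fixes a :: "'a::comm_ring_1"
  assumes "pCons c Q = [:- a, 1:] * R"
  shows "poly Q a = poly.coeff R 0"
proof -
  obtain r S where R: "R = pCons r S" by (cases R) auto
  have "[:- a, 1:] * R = pCons (- a * r) ([:r:] + [:- a, 1:] * S)"
    unfolding R by simp
  with assms have "Q = [:r:] + [:- a, 1:] * S" by simp
  then show ?thesis by (simp add: R)
qed

text \<open>
  By the product rule, both sides are the derivative of the given polynomial at \<open>0\<close>: omitting the
  factor of index \<open>i\<close> leaves the cofactor of the root \<open>a i\<close>, whose constant term is \<open>Q (a i)\<close>.
\<close>

lemma sum_poly_quotient_at_roots:
  fixes a :: "'i \<Rightarrow> 'a::idom"
  assumes fin: "finite I" and P: "pCons c Q = (\<Prod>i\<in>I. [:- a i, 1:])"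
  shows "(\<Sum>i\<in>I. poly Q (a i)) = poly.coeff Q 0"
proof -
  have "poly Q (a i) = poly.coeff (\<Prod>j\<in>I - {i}. [:- a j, 1:]) 0" if "i \<in> I" for i
    using P prod.remove[OF fin that, of "\<lambda>i. [:- a i, 1:]"]
    by (intro poly_quotient_at_root[of c]) simp
  then have "(\<Sum>i\<in>I. poly Q (a i)) = poly.coeff (\<Sum>i\<in>I. \<Prod>j\<in>I - {i}. [:- a j, 1:]) 0"
    by (simp add: coeff_sum)
  also have "(\<Sum>i\<in>I. \<Prod>j\<in>I - {i}. [:- a j, 1:]) = pderiv (pCons c Q)"
    unfolding P pderiv_prod by (simp add: pderiv_pCons)
  also have "poly.coeff \<dots> 0 = poly.coeff Q 0" by (simp add: pderiv_pCons)
  finally show ?thesis .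
qed

lemma coeff_prod_linear_subleading:
  fixes a :: "nat \<Rightarrow> 'a::idom"
  shows "poly.coeff (\<Prod>i<Suc n. [:- a i, 1:]) n = - (\<Sum>i<Suc n. a i)"
proof (induction n)
  case (Suc n)
  have "lead_coeff (\<Prod>i<Suc n. [:- a i, 1:]) = 1"
    by (subst lead_coeff_prod) simp
  moreover have "degree (\<Prod>i<Suc n. [:- a i, 1:]) = Suc n"
    by (subst degree_prod_eq_sum_degree) auto
  ultimately have "poly.coeff (\<Prod>i<Suc n. [:- a i, 1:]) (Suc n) = 1" by metis
  moreover have "poly.coeff (\<Prod>i<Suc (Suc n). [:- a i, 1:]) (Suc n) =
      poly.coeff (\<Prod>i<Suc n. [:- a i, 1:]) n - a (Suc n) * poly.coeff (\<Prod>i<Suc n. [:- a i, 1:]) (Suc n)"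
    by (subst prod.lessThan_Suc) (simp del: prod.lessThan_Suc add: mult.commute[of _ "[:_, 1:]"])
  ultimately show ?case using Suc.IH by simp
qed simp

section \<open>Characters of the cyclic group\<close>

definition root_of_unity :: "nat \<Rightarrow> complex" where
  "root_of_unity n = cis (2 * pi / real n)"

lemma root_of_unity_power: "root_of_unity n ^ k = cis (2 * pi * real k / real n)"
  by (simp add: root_of_unity_def DeMoivre mult_ac)

lemma root_of_unity_power_order: "n > 0 \<Longrightarrow> root_of_unity n ^ n = 1"
  by (simp add: root_of_unity_power)

lemma inj_on_root_of_unity_power: "n > 0 \<Longrightarrow> inj_on (\<lambda>k. root_of_unity n ^ k) {..<n}"
  unfolding root_of_unity_power using bij_betw_roots_unity by (rule bij_betw_imp_inj_on)

lemma root_of_unity_nonzero [simp]: "root_of_unity n \<noteq> 0"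
  by (simp add: root_of_unity_def)

definition character :: "nat \<Rightarrow> 'n::finite mod_ring \<Rightarrow> complex" where
  "character m a = (root_of_unity CARD('n) ^ m) ^ nat (to_int_mod_ring a)"

text \<open>
  The exponent may be any representative of the class, because the base is an \<open>n\<close>-th root of unity;
  multiplicativity of the character rests on this.
\<close>

lemma character_cls:
  "character m (cls k :: 'n::finite mod_ring) = (root_of_unity CARD('n) ^ m) ^ k"
proof -
  let ?w = "root_of_unity CARD('n) ^ m"
  have "?w ^ CARD('n) = (root_of_unity CARD('n) ^ CARD('n)) ^ m"
    by (simp only: power_mult [symmetric] mult.commute)
  then have w: "?w ^ CARD('n) = 1"
    by (simp add: root_of_unity_power_order)
  have "?w ^ k = ?w ^ (CARD('n) * (k div CARD('n)) + k mod CARD('n))" by simp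
  also have "\<dots> = ?w ^ (k mod CARD('n))"
    by (simp only: power_add power_mult w power_one mult_1)
  also have "k mod CARD('n) = nat (to_int_mod_ring (cls k :: 'n mod_ring))"
    unfolding cls_def by transfer (simp add: nat_mod_as_int)
  finally show ?thesis by (simp add: character_def)
qed

lemma cls_cases: obtains k where "k < CARD('n)" "a = (cls k :: 'n::finite mod_ring)"
  using cls_range[where 'n = 'n] by (metis UNIV_I imageE lessThan_iff)

lemma character_add: "character m (a + b) = character m a * character m b"
  by (metis cls_cases cls_add character_cls power_add)

text \<open>
  The linear extension of \<open>character m\<close> to the group algebra, or equivalently the \<open>m\<close>-th discrete
  Fourier coefficient of \<open>x\<close>. It is named for its role as an eigenvalue of the circulant of \<open>x\<close>.
\<close>

definition spectral_value :: "nat \<Rightarrow> 'n::finite cyclic_algebra \<Rightarrow> complex" where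
  "spectral_value m x = (\<Sum>a\<in>UNIV. Poly_Mapping.lookup x a * character m a)"

lemma spectral_value_add: "spectral_value m (x + y) = spectral_value m x + spectral_value m y"
  by (simp add: spectral_value_def lookup_add distrib_right sum.distrib)

lemma spectral_value_sum: "spectral_value m (sum f A) = (\<Sum>i\<in>A. spectral_value m (f i))"
  by (induction A rule: infinite_finite_induct)
    (simp_all add: spectral_value_add, simp_all add: spectral_value_def)

lemma spectral_value_single:
  "spectral_value m (Poly_Mapping.single a c) = c * character m a"
proof -
  have "spectral_value m (Poly_Mapping.single a c) = (\<Sum>b\<in>UNIV. if b = a then c * character m b else 0)"
    unfolding spectral_value_def by (intro sum.cong) (auto simp: lookup_single when_def)
  then show ?thesis by simp
qed

lemma sum_singles:
  fixes x :: "'n::finite cyclic_algebra"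
  shows "x = (\<Sum>a\<in>UNIV. Poly_Mapping.single a (Poly_Mapping.lookup x a))"
  by (rule poly_mapping_eqI) (simp add: lookup_sum lookup_single when_def)

text \<open>
  The convolution product is bilinear, so multiplicativity reduces to products of group elements,
  where it is the homomorphism property of the character.
\<close>

lemma spectral_value_mult: "spectral_value m (x * y) = spectral_value m x * spectral_value m y"
proof -
  have "x * y = (\<Sum>a\<in>UNIV. \<Sum>b\<in>UNIV.
      Poly_Mapping.single (a + b) (Poly_Mapping.lookup x a * Poly_Mapping.lookup y b))"
    by (subst sum_singles[of x], subst sum_singles[of y]) (simp add: sum_product mult_single)
  then show ?thesis
    by (simp add: spectral_value_sum spectral_value_single character_add)
      (simp add: spectral_value_def sum_product mult_ac)
qed

lemma character_zero: "character m (0 :: 'n::finite mod_ring) = 1"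
  using character_cls[of m 0, where 'n = 'n] by (simp add: cls_def)

lemma spectral_value_scalar:
  "spectral_value m (Poly_Mapping.single 0 c :: 'n::finite cyclic_algebra) = c"
  by (simp add: spectral_value_single character_zero)

lemma spectral_value_power:
  fixes x :: "'n::finite cyclic_algebra"
  shows "spectral_value m (x ^ k) = spectral_value m x ^ k"
  using spectral_value_scalar[of m 1, where 'n = 'n]
  by (induction k) (simp_all add: spectral_value_mult)

section \<open>The spectrum of a circulant matrix\<close>

lemma circ_coeffs_vec_entry:
  fixes x :: "'n::finite cyclic_algebra"
  assumes "i < CARD('n)" "j < CARD('n)"
  shows "circ (coeffs_vec x) $$ (i, j) = Poly_Mapping.lookup x (cls j - cls i)"
proof -
  have "cls (nat ((int j - int i) mod int CARD('n))) = (cls j - cls i :: 'n mod_ring)"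
    unfolding cls_def by transfer (simp add: mod_simps)
  with assms show ?thesis by (simp add: circ_def coeffs_vec_def nat_less_iff)
qed

definition fourier_mat :: "nat \<Rightarrow> complex mat" where
  "fourier_mat n = mat n n (\<lambda>(i, j). root_of_unity n ^ (i * j))"

definition fourier_inv_mat :: "nat \<Rightarrow> complex mat" where
  "fourier_inv_mat n = mat n n (\<lambda>(i, j). inverse (root_of_unity n ^ (i * j)) / of_nat n)"

text \<open>
  This is the orthogonality of characters. The \<open>(i, l)\<close> entry of the product is a geometric sum in
  the ratio \<open>z\<close> of the \<open>i\<close>-th and \<open>l\<close>-th powers of the root of unity: it vanishes for \<open>z \<noteq> 1\<close>,
  since \<open>z\<^sup>n = 1\<close>, and has \<open>n\<close> equal terms otherwise.
\<close>

lemma fourier_mat_inverse: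
  assumes "n > 0"
  shows "fourier_mat n * fourier_inv_mat n = 1\<^sub>m n"
proof (rule eq_matI)
  fix i l assume il: "i < dim_row (1\<^sub>m n :: complex mat)" "l < dim_col (1\<^sub>m n :: complex mat)"
  define z where "z = root_of_unity n ^ i / root_of_unity n ^ l"
  have "(fourier_mat n * fourier_inv_mat n) $$ (i, l) = (\<Sum>j<n. z ^ j) / of_nat n"
  proof -
    have "z ^ j = root_of_unity n ^ (i * j) * inverse (root_of_unity n ^ (j * l))" for j
      unfolding z_def power_divide by (simp add: divide_inverse mult.commute[of j] flip: power_mult)
    then show ?thesis
      using il by (simp add: fourier_mat_def fourier_inv_mat_def scalar_prod_def sum_divide_distrib
          lessThan_atLeast0)
  qed
  also have "\<dots> = (if i = l then 1 else 0)"
  proof (cases "i = l")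
    case True
    then show ?thesis using assms by (simp add: z_def)
  next
    case False
    then have "root_of_unity n ^ i \<noteq> root_of_unity n ^ l"
      using inj_on_root_of_unity_power[OF assms] il by (auto dest: inj_onD)
    then have "z \<noteq> 1" by (simp add: z_def)
    moreover have "z ^ n = 1"
      unfolding z_def power_divide
      by (metis assms div_by_1 mult.commute power_mult power_one root_of_unity_power_order)
    ultimately show ?thesis using False by (simp add: geometric_sum)
  qed
  finally show "(fourier_mat n * fourier_inv_mat n) $$ (i, l) = 1\<^sub>m n $$ (i, l)"
    using il by simp
qed (simp_all add: fourier_mat_def fourier_inv_mat_def)

text \<open>
  The columns of the Fourier matrix are the value vectors of the characters. Each is an eigenvector:
  the \<open>i\<close>-th row of the circulant is \<open>x\<close> translated by \<open>i\<close>, and moving the translation to the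
  character pulls out the factor \<open>character m (cls i)\<close>.
\<close>

lemma circ_mult_fourier_mat:
  fixes x :: "'n::finite cyclic_algebra"
  defines "n \<equiv> CARD('n)"
  shows "circ (coeffs_vec x) * fourier_mat n =
    fourier_mat n * mat n n (\<lambda>(i, j). if i = j then spectral_value i x else 0)"
    (is "_ = _ * ?D")
proof (rule eq_matI)
  fix i m assume "i < dim_row (fourier_mat n * ?D)" "m < dim_col (fourier_mat n * ?D)"
  then have im: "i < n" "m < n" by (simp_all add: fourier_mat_def)
  have "(circ (coeffs_vec x) * fourier_mat n) $$ (i, m) =
      (\<Sum>j<n. circ (coeffs_vec x) $$ (i, j) * root_of_unity n ^ (j * m))"
    using im by (simp add: scalar_prod_def fourier_mat_def circ_def coeffs_vec_def n_def
        lessThan_atLeast0)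
  also have "\<dots> = (\<Sum>j<n. Poly_Mapping.lookup x (cls j - cls i) * character m (cls j :: 'n mod_ring))"
    using im unfolding n_def
    by (intro sum.cong) (simp_all add: circ_coeffs_vec_entry character_cls mult.commute flip: power_mult)
  also have "\<dots> = (\<Sum>b\<in>UNIV. Poly_Mapping.lookup x (b - cls i) * character m b)"
    unfolding n_def cls_range[symmetric] by (simp add: sum.reindex[OF cls_inj])
  also have "\<dots> = (\<Sum>a\<in>UNIV. Poly_Mapping.lookup x a * character m (a + cls i))"
    by (rule sum.reindex_bij_witness[of _ "\<lambda>a. a + cls i" "\<lambda>b. b - cls i"]) auto
  also have "\<dots> = root_of_unity n ^ (i * m) * spectral_value m x"
    by (simp add: character_add character_cls spectral_value_def sum_distrib_left n_def
        mult_ac flip: power_mult)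
  also have "\<dots> = (\<Sum>j<n. root_of_unity n ^ (i * j) * (if j = m then spectral_value j x else 0))"
    using im by (simp add: if_distrib[of "\<lambda>y. _ * y"] cong: if_cong)
  also have "\<dots> = (fourier_mat n * ?D) $$ (i, m)"
    using im by (simp add: scalar_prod_def fourier_mat_def lessThan_atLeast0)
  finally show "(circ (coeffs_vec x) * fourier_mat n) $$ (i, m) = (fourier_mat n * ?D) $$ (i, m)" .
qed (simp_all add: fourier_mat_def circ_def coeffs_vec_def n_def)

lemma char_poly_circ:
  fixes x :: "'n::finite cyclic_algebra"
  shows "char_poly (circ (coeffs_vec x)) = (\<Prod>m<CARD('n). [:- spectral_value m x, 1:])"
proof -
  let ?n = "CARD('n)" and ?C = "circ (coeffs_vec x)"
  let ?F = "fourier_mat ?n" and ?G = "fourier_inv_mat ?n"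
  let ?D = "mat ?n ?n (\<lambda>(i, j). if i = j then spectral_value i x else 0)"
  have carrier: "?C \<in> carrier_mat ?n ?n" "?F \<in> carrier_mat ?n ?n" "?G \<in> carrier_mat ?n ?n"
    "?D \<in> carrier_mat ?n ?n"
    by (simp_all add: circ_def coeffs_vec_def fourier_mat_def fourier_inv_mat_def)
  have FG: "?F * ?G = 1\<^sub>m ?n" by (simp add: fourier_mat_inverse)
  then have GF: "?G * ?F = 1\<^sub>m ?n"
    using mat_mult_left_right_inverse carrier by blast
  have "?F * ?D * ?G = ?C * (?F * ?G)"
    using carrier by (simp add: assoc_mult_mat[of _ ?n ?n _ ?n _ ?n] flip: circ_mult_fourier_mat)
  then have C: "?C = ?F * ?D * ?G" using carrier(1) by (simp only: FG right_mult_one_mat)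
  have "similar_mat ?C ?D"
    using carrier by (intro similar_matI[OF _ FG GF C]) blast
  then have "char_poly ?C = char_poly ?D" by (rule char_poly_similar)
  also have "\<dots> = (\<Prod>a\<leftarrow>diag_mat ?D. [:- a, 1:])"
    using carrier(4) by (rule char_poly_upper_triangular) auto
  also have "diag_mat ?D = map (\<lambda>m. spectral_value m x) [0..<?n]"
    by (simp add: diag_mat_def)
  finally show ?thesis
    using prod.distinct_set_conv_list[of "[0..<?n]" "\<lambda>m. [:- spectral_value m x, 1:]"]
    by (simp add: o_def lessThan_atLeast0)
qed

section \<open>The conjugate\<close>

lemma q_1_eq_sum_spectral_values:
  fixes x :: "'n::finite cyclic_algebra"
  shows "q 1 x = (\<Sum>m<CARD('n). spectral_value m x)"
proof -
  obtain n where "CARD('n) = Suc n" using zero_less_card_finite gr0_conv_Suc by blast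
  then show ?thesis
    using coeff_prod_linear_subleading[of "\<lambda>m. spectral_value m x" n]
    by (simp add: q_def char_poly_circ del: prod.lessThan_Suc sum.lessThan_Suc)
qed

text \<open>
  As \<open>q k x\<close> is up to the sign \<open>(-1)\<^sup>k\<close> the coefficient of degree \<open>n - k\<close> of the characteristic
  polynomial, the signs in the definition of the conjugate combine to the constant
  \<open>(-1)\<^bsup>n+1\<^esup>\<close>. What remains is \<open>Q\<close> evaluated at \<open>x\<close>, and algebra homomorphisms commute with
  evaluation.
\<close>

lemma spectral_value_conjugate_elt:
  fixes x :: "'n::finite cyclic_algebra"
  assumes P: "char_poly (circ (coeffs_vec x)) = pCons c Q"
  shows "spectral_value m (conjugate_elt x) = (-1) ^ (CARD('n) + 1) * poly Q (spectral_value m x)"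
proof -
  let ?n = "CARD('n)" and ?v = "spectral_value m x"
  have "degree (char_poly (circ (coeffs_vec x))) = ?n"
    by (simp add: char_poly_circ degree_prod_eq_sum_degree)
  then have "?n = Suc (degree Q)"
    using zero_less_card_finite[where 'a='n] unfolding P by (auto split: if_splits)
  then have Q: "poly Q ?v = (\<Sum>j<?n. poly.coeff Q j * ?v ^ j)"
    by (simp only: poly_altdef lessThan_Suc_atMost)
  have "spectral_value m (conjugate_elt x) = (\<Sum>k<?n. (-1) ^ (?n + 1 + k) * q k x * ?v ^ (?n - 1 - k))"
    by (simp add: conjugate_elt_def spectral_value_sum spectral_value_mult spectral_value_scalar
        spectral_value_power)
  also have "\<dots> = (\<Sum>k<?n. (-1) ^ (?n + 1) * (poly.coeff Q (?n - 1 - k) * ?v ^ (?n - 1 - k)))"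
  proof (rule sum.cong)
    fix k assume "k \<in> {..<?n}"
    then have "?n - k = Suc (?n - 1 - k)" by auto
    then have "q k x = (-1) ^ k * poly.coeff Q (?n - 1 - k)"
      by (simp only: q_def P coeff_pCons_Suc)
    moreover have "(-1) ^ (?n + 1 + k) * (-1) ^ k = ((-1) ^ (?n + 1) :: complex)"
      by (simp add: power_add mult.assoc flip: power_mult_distrib)
    ultimately show "(-1) ^ (?n + 1 + k) * q k x * ?v ^ (?n - 1 - k) =
        (-1) ^ (?n + 1) * (poly.coeff Q (?n - 1 - k) * ?v ^ (?n - 1 - k))"
      by (metis mult.assoc)
  qed simp
  also have "\<dots> = (-1) ^ (?n + 1) * (\<Sum>k<?n. poly.coeff Q (?n - 1 - k) * ?v ^ (?n - 1 - k))"
    by (simp add: sum_distrib_left)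
  also have "(\<Sum>k<?n. poly.coeff Q (?n - 1 - k) * ?v ^ (?n - 1 - k)) = poly Q ?v"
    unfolding Q by (rule sum.reindex_bij_witness[of _ "\<lambda>k. ?n - 1 - k" "\<lambda>k. ?n - 1 - k"]) auto
  finally show ?thesis .
qed

theorem proposition2p9:
  fixes x :: "'n::finite cyclic_algebra"
  assumes "CARD('n) \<ge> 2"
  shows "q 1 (conjugate_elt x) = q (CARD('n) - 1) x"
proof -
  let ?n = "CARD('n)"
  obtain c Q where P: "char_poly (circ (coeffs_vec x)) = pCons c Q" by (rule pCons_cases)
  have "q 1 (conjugate_elt x) = (-1) ^ (?n + 1) * (\<Sum>m<?n. poly Q (spectral_value m x))"
    unfolding q_1_eq_sum_spectral_values by (simp add: spectral_value_conjugate_elt[OF P] sum_distrib_left)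
  also have "(\<Sum>m<?n. poly Q (spectral_value m x)) = poly.coeff Q 0"
    using P char_poly_circ[of x] by (intro sum_poly_quotient_at_roots[of _ c]) auto
  also have "(-1) ^ (?n + 1) * poly.coeff Q 0 = (-1) ^ (?n - 1) * poly.coeff (pCons c Q) (?n - (?n - 1))"
  proof -
    have "?n + 1 = (?n - 1) + 2" using assms by simp
    then have "(-1) ^ (?n + 1) = ((-1) ^ (?n - 1) :: complex)"
      by (simp only: power_add) simp
    moreover have "?n - (?n - 1) = Suc 0" using assms by simp
    ultimately show ?thesis by (simp only: coeff_pCons_Suc)
  qed
  finally show ?thesis by (simp add: q_def P)
qed

end
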